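(* For any dataset $(\mathbf{X},y)$ it holds that $\mathrm{DegNSEP}^* = \mathrm{PertSEP}^*$.
   Context: A dataset $(\mathbf{X},y)$ consists of a matrix $\mathbf{X}\in\mathbb{R}^{n\times p}$ whose $i$-th row is $\mathbf{x}_i$ ($\mathbf{x}_i\in\mathbb{R}^p$), and $y\in\{-1,1\}^n$. The dataset is separable if there exists $\beta\in\mathbb{R}^p$ with $y_i\beta^T\mathbf{x}_i>0$ for all $i=1,\ldots,n$. Let $\|\cdot\|$ be a given (arbitrary) norm on $\mathbb{R}^p$, and for $A\in\mathbb{R}^{n\times p}$ let $\|A\|_{\cdot,1} := \max_{\|\beta\|\le 1}\|A\beta\|_1$. For a scalar $t$, $[t]^-:=\max\{-t,0\}$. Define $$\mathrm{DegNSEP}^* := \min_{\beta\in\mathbb{R}^p:\ \|\beta\|=1}\ \frac1n\sum_{i=1}^n [y_i\beta^T\mathbf{x}_i]^-,$$ $$\mathrm{PertSEP}^* := \inf\Big\{\tfrac1n\|\Delta\mathbf{X}\|_{\cdot,1} \ :\ \Delta\mathbf{X}\in\mathbb{R}^{n\times p},\ (\mathbf{X}+\Delta\mathbf{X},y)\text{ is separable}\Big\}.$$ *)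

theory Defs
  imports "HOL-Analysis.Analysis"
begin

text \<open>
  The library fixes one norm per type (for \<^typ>\<open>real ^ 'p\<close>, the Euclidean one), so an arbitrary
  norm is a function satisfying the norm axioms.
\<close>

definition is_norm :: "('a::real_vector \<Rightarrow> real) \<Rightarrow> bool" where
  "is_norm N \<longleftrightarrow>
     (\<forall>x. N x \<ge> 0) \<and>
     (\<forall>x. N x = 0 \<longleftrightarrow> x = 0) \<and>
     (\<forall>c x. N (c *\<^sub>R x) = \<bar>c\<bar> * N x) \<and>
     (\<forall>x y. N (x + y) \<le> N x + N y)"

definition l1_norm :: "real ^ 'n \<Rightarrow> real" where
  "l1_norm v = (\<Sum>i\<in>UNIV. \<bar>v $ i\<bar>)"

definition is_dataset :: "real ^ 'p ^ 'n \<Rightarrow> real ^ 'n \<Rightarrow> bool" where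
  "is_dataset X y \<longleftrightarrow> (\<forall>i. y $ i \<in> {-1, 1})"

definition separable_data :: "real ^ 'p ^ 'n \<Rightarrow> real ^ 'n \<Rightarrow> bool" where
  "separable_data X y \<longleftrightarrow> (\<exists>\<beta>. \<forall>i. y $ i * (\<beta> \<bullet> row i X) > 0)"

text \<open>
  The maximum and the minimum below are literal: \<^const>\<open>Greatest\<close> and \<^const>\<open>Least\<close> denote the
  greatest and least element of the set of attained values.  These exist because the unit ball and
  the unit sphere of a norm on \<^typ>\<open>real ^ 'p\<close> are nonempty and compact.
\<close>

definition op_norm1 :: "(real ^ 'p \<Rightarrow> real) \<Rightarrow> real ^ 'p ^ 'n \<Rightarrow> real" where
  "op_norm1 N A = (GREATEST v. \<exists>\<beta>. N \<beta> \<le> 1 \<and> v = l1_norm (A *v \<beta>))"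

definition neg_part :: "real \<Rightarrow> real" where
  "neg_part t = max (- t) 0"

definition DegNSEP :: "(real ^ 'p \<Rightarrow> real) \<Rightarrow> real ^ 'p ^ 'n \<Rightarrow> real ^ 'n \<Rightarrow> real" where
  "DegNSEP N X y =
     (LEAST v. \<exists>\<beta>. N \<beta> = 1 \<and>
        v = 1 / real CARD('n) * (\<Sum>i\<in>UNIV. neg_part (y $ i * (\<beta> \<bullet> row i X))))"

definition PertSEP :: "(real ^ 'p \<Rightarrow> real) \<Rightarrow> real ^ 'p ^ 'n \<Rightarrow> real ^ 'n \<Rightarrow> real" where
  "PertSEP N X y =
     Inf {1 / real CARD('n) * op_norm1 N \<Delta> | \<Delta>. separable_data (X + \<Delta>) y}"

end

theory Submission
  imports Defs
begin

text \<open>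
  A perturbation \<open>\<Delta>\<close> that makes the data separable by a vector \<open>\<beta>\<close> of norm one satisfies
  \<open>[y\<^sub>i \<beta>\<^sup>T x\<^sub>i]\<^sup>- \<le> \<bar>(\<Delta> \<beta>)\<^sub>i\<bar>\<close> for each \<open>i\<close>, which bounds the degree of non-separability from above
  by the operator norm of \<open>\<Delta>\<close>. Conversely, let \<open>\<beta>\<close> minimise the degree of non-separability and
  let \<open>u\<close> be a dual vector of \<open>\<beta>\<close>, that is, \<open>u \<bullet> \<beta> = 1\<close> and \<open>\<bar>u \<bullet> x\<bar> \<le> N x\<close> for all \<open>x\<close>. The rank-one
  perturbation with rows \<open>y\<^sub>i ([y\<^sub>i \<beta>\<^sup>T x\<^sub>i]\<^sup>- + \<epsilon>) u\<close> makes \<open>\<beta>\<close> separating and has operator norm at most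
  the sum of the coefficients \<open>[y\<^sub>i \<beta>\<^sup>T x\<^sub>i]\<^sup>- + \<epsilon>\<close>.
\<close>

section \<open>Norms on a Euclidean space: continuity, compactness and dual vectors\<close>

lemma is_normD:
  assumes "is_norm N"
  shows "N x \<ge> 0" "N x = 0 \<longleftrightarrow> x = 0" "N (c *\<^sub>R x) = \<bar>c\<bar> * N x" "N (x + y) \<le> N x + N y"
  using assms by (auto simp: is_norm_def)

lemma is_norm_minus:
  assumes "is_norm N"
  shows "N (- x) = N x"
  using is_normD(3)[OF assms, of "-1" x] by simp

lemma is_norm_pos:
  assumes "is_norm N" "x \<noteq> 0"
  shows "N x > 0"
  using is_normD(1,2)[OF assms(1), of x] assms(2) by linarith

lemma is_norm_normalized:
  assumes "is_norm N" "x \<noteq> 0"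
  shows "N ((1 / N x) *\<^sub>R x) = 1"
  using is_norm_pos[OF assms] by (simp add: is_normD(3)[OF assms(1)])

lemma is_norm_convex_on:
  assumes "is_norm N"
  shows "convex_on UNIV N"
proof (rule convex_onI)
  fix t x y assume "0 < t" "t < (1::real)"
  then show "N ((1 - t) *\<^sub>R x + t *\<^sub>R y) \<le> (1 - t) * N x + t * N y"
    using is_normD(4)[OF assms, of "(1 - t) *\<^sub>R x" "t *\<^sub>R y"] by (simp add: is_normD(3)[OF assms])
qed simp

text \<open>The triangle inequality and homogeneity make \<open>N\<close> convex, and a real-valued
  convex function on an open set in finite dimension is continuous.\<close>

lemma is_norm_continuous_on:
  fixes N :: "'a::euclidean_space \<Rightarrow> real"
  assumes "is_norm N"
  shows "continuous_on S N"
  using convex_on_continuous[OF open_UNIV is_norm_convex_on[OF assms]]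
  by (rule continuous_on_subset) simp

text \<open>By homogeneity \<open>m\<close> can be the minimum of \<open>N\<close> on the Euclidean
  unit sphere, which is attained by compactness and positive by definiteness.\<close>

lemma is_norm_dominates_norm:
  fixes N :: "'a::euclidean_space \<Rightarrow> real"
  assumes "is_norm N"
  obtains m where "m > 0" "\<And>x. m * norm x \<le> N x"
proof -
  obtain z where z: "z \<in> sphere 0 1" "\<And>x. x \<in> sphere 0 1 \<Longrightarrow> N z \<le> N x"
    using continuous_attains_inf[of "sphere 0 1" N] is_norm_continuous_on[OF assms] by auto
  have "N z * norm x \<le> N x" for x
  proof (cases "x = 0")
    case True
    then show ?thesis using is_normD(1)[OF assms] by simp
  next
    case False
    then have "N z \<le> N ((1 / norm x) *\<^sub>R x)"
      by (intro z(2)) simp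
    then show ?thesis
      using False by (simp add: is_normD(3)[OF assms] field_simps)
  qed
  moreover have "N z > 0"
    using z(1) by (intro is_norm_pos[OF assms]) auto
  ultimately show thesis
    using that by blast
qed

lemma is_norm_compact_vimage:
  fixes N :: "'a::euclidean_space \<Rightarrow> real"
  assumes "is_norm N" "compact K"
  shows "compact (N -` K)"
proof -
  obtain m where m: "m > 0" "\<And>x. m * norm x \<le> N x"
    by (rule is_norm_dominates_norm[OF assms(1)]) blast
  obtain B where B: "\<And>r. r \<in> K \<Longrightarrow> norm r \<le> B"
    using compact_imp_bounded[OF assms(2)] by (auto simp: bounded_iff)
  have "norm x \<le> B / m" if "x \<in> N -` K" for x
  proof -
    have "N x \<le> B" using B[of "N x"] that by simp
    then show ?thesis
      using m(1) m(2)[of x] by (simp add: pos_le_divide_eq mult.commute)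
  qed
  then have "bounded (N -` K)"
    by (auto simp: bounded_iff)
  moreover have "closed (N -` K)"
    using is_norm_continuous_on[OF assms(1), of UNIV] compact_imp_closed[OF assms(2)]
    by (simp add: continuous_on_closed_vimage)
  ultimately show ?thesis
    by (simp add: compact_eq_bounded_closed)
qed

text \<open>
  The Hahn--Banach theorem for the line through \<open>b\<close>: the dual vector is the normal of a hyperplane
  separating \<open>b\<close> from the open unit ball.
\<close>

lemma is_norm_dual_vector:
  fixes N :: "'a::euclidean_space \<Rightarrow> real"
  assumes "is_norm N" "N b = 1"
  obtains u where "u \<bullet> b = 1" "\<And>x. \<bar>u \<bullet> x\<bar> \<le> N x"
proof -
  note N = is_normD[OF assms(1)]
  have "convex {x. N x < 1}"
  proof (rule convexI)
    fix x y and s t :: real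
    assume "x \<in> {x. N x < 1}" "y \<in> {x. N x < 1}" "0 \<le> s" "0 \<le> t" "s + t = 1"
    then show "s *\<^sub>R x + t *\<^sub>R y \<in> {x. N x < 1}"
      using convex_lower[OF is_norm_convex_on[OF assms(1)], of x y s t] by auto
  qed
  moreover have "N 0 < 1" using N(2)[of 0] by simp
  ultimately obtain a r where a: "a \<noteq> 0" "\<And>x. N x < 1 \<Longrightarrow> a \<bullet> x \<le> r" "r \<le> a \<bullet> b"
    using separating_hyperplane_sets[of "{x. N x < 1}" "{b}"] assms(2) by auto
  have Na: "N a > 0" using is_norm_pos[OF assms(1) a(1)] .
  \<comment> \<open>Testing the hyperplane at \<open>a\<close> itself, shrunk to
    \<open>N\<close>-length 1/2, shows that \<open>a \<bullet> b\<close> is positive, so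
    \<open>a\<close> can be rescaled by it.\<close>
  have "a \<bullet> ((1 / (2 * N a)) *\<^sub>R a) \<le> a \<bullet> b"
    using a(2)[of "(1 / (2 * N a)) *\<^sub>R a"] a(3) Na by (simp add: N(3))
  moreover have "a \<bullet> ((1 / (2 * N a)) *\<^sub>R a) > 0"
    using a(1) Na by simp
  ultimately have ab: "a \<bullet> b > 0" by linarith
  have le: "a \<bullet> x \<le> (a \<bullet> b) * N x" for x
  \<comment> \<open>The hyperplane bounds only the open ball, so \<open>x\<close> is scaled to
    length \<open>t < 1\<close>; the bound for all such \<open>t\<close> gives the limit
    case.\<close>
  proof (rule field_le_mult_one_interval)
    fix t :: real assume t: "0 < t" "t < 1"
    show "t * (a \<bullet> x) \<le> (a \<bullet> b) * N x"
    proof (cases "x = 0")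
      case True
      then show ?thesis using N(2)[of 0] by simp
    next
      case False
      then have Nx: "N x > 0" by (rule is_norm_pos[OF assms(1)])
      have "a \<bullet> ((t / N x) *\<^sub>R x) \<le> a \<bullet> b"
        using a(2)[of "(t / N x) *\<^sub>R x"] a(3) Nx t by (simp add: N(3))
      then show ?thesis
        using Nx by (simp add: field_simps)
    qed
  qed
  have "\<bar>((1 / (a \<bullet> b)) *\<^sub>R a) \<bullet> x\<bar> \<le> N x" for x
  proof -
    have "\<bar>a \<bullet> x\<bar> \<le> (a \<bullet> b) * N x"
      using le[of x] le[of "- x"] by (simp add: is_norm_minus[OF assms(1)])
    then show ?thesis
      using ab by (simp add: abs_mult field_simps)
  qed
  moreover have "((1 / (a \<bullet> b)) *\<^sub>R a) \<bullet> b = 1"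
    using ab by simp
  ultimately show thesis
    using that by blast
qed

section \<open>Attainment of the maximum and the minimum\<close>

lemma Greatest_attained:
  fixes f :: "'a::topological_space \<Rightarrow> 'b::linorder_topology"
  assumes "compact {x. P x}" "P z" "continuous_on {x. P x} f"
  obtains m where "P m" "(GREATEST v. \<exists>x. P x \<and> v = f x) = f m" "\<And>x. P x \<Longrightarrow> f x \<le> f m"
proof -
  obtain m where m: "P m" "\<And>x. P x \<Longrightarrow> f x \<le> f m"
    using continuous_attains_sup[OF assms(1) _ assms(3)] assms(2) by auto
  have "(GREATEST v. \<exists>x. P x \<and> v = f x) = f m"
    by (rule Greatest_equality) (use m in auto)
  with m show thesis using that by blast
qed

lemma Least_attained:
  fixes f :: "'a::topological_space \<Rightarrow> 'b::linorder_topology"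
  assumes "compact {x. P x}" "P z" "continuous_on {x. P x} f"
  obtains m where "P m" "(LEAST v. \<exists>x. P x \<and> v = f x) = f m" "\<And>x. P x \<Longrightarrow> f m \<le> f x"
proof -
  obtain m where m: "P m" "\<And>x. P x \<Longrightarrow> f m \<le> f x"
    using continuous_attains_inf[OF assms(1) _ assms(3)] assms(2) by auto
  have "(LEAST v. \<exists>x. P x \<and> v = f x) = f m"
    by (rule Least_equality) (use m in auto)
  with m show thesis using that by blast
qed

lemma op_norm1_attained:
  fixes N :: "real ^ 'p \<Rightarrow> real" and A :: "real ^ 'p ^ 'n"
  assumes "is_norm N"
  obtains \<beta> where "N \<beta> \<le> 1" "op_norm1 N A = l1_norm (A *v \<beta>)"
    "\<And>\<gamma>. N \<gamma> \<le> 1 \<Longrightarrow> l1_norm (A *v \<gamma>) \<le> op_norm1 N A"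
proof -
  \<comment> \<open>Nonnegativity of \<open>N\<close> permits the compact interval
    \<open>{0..1}\<close> in place of an unbounded half-line.\<close>
  have eq: "{\<beta>. N \<beta> \<le> 1} = N -` {0..1}"
    using is_normD(1)[OF assms] by auto
  have "compact {\<beta>. N \<beta> \<le> 1}"
    unfolding eq by (rule is_norm_compact_vimage[OF assms]) simp
  moreover have "N 0 \<le> 1" using is_normD(2)[OF assms, of 0] by simp
  moreover have "continuous_on {\<beta>. N \<beta> \<le> 1} (\<lambda>\<beta>. l1_norm (A *v \<beta>))"
    unfolding l1_norm_def matrix_vector_mult_def by (auto intro!: continuous_intros)
  ultimately obtain m where "N m \<le> 1" "op_norm1 N A = l1_norm (A *v m)"
      "\<And>\<gamma>. N \<gamma> \<le> 1 \<Longrightarrow> l1_norm (A *v \<gamma>) \<le> l1_norm (A *v m)"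
    unfolding op_norm1_def by (rule Greatest_attained) blast
  then show thesis using that by simp
qed

lemma DegNSEP_attained:
  fixes N :: "real ^ 'p \<Rightarrow> real" and X :: "real ^ 'p ^ 'n" and y :: "real ^ 'n"
  defines "h \<equiv> \<lambda>\<beta>. 1 / real CARD('n) * (\<Sum>i\<in>UNIV. neg_part (y $ i * (\<beta> \<bullet> row i X)))"
  assumes "is_norm N"
  obtains \<beta> where "N \<beta> = 1" "DegNSEP N X y = h \<beta>" "\<And>\<gamma>. N \<gamma> = 1 \<Longrightarrow> DegNSEP N X y \<le> h \<gamma>"
proof -
  have eq: "{\<beta>. N \<beta> = 1} = N -` {1}" by auto
  have "compact {\<beta>. N \<beta> = 1}"
    unfolding eq by (rule is_norm_compact_vimage[OF assms(2)]) simp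
  \<comment> \<open>The all-ones vector is nonzero since index types are nonempty; normalised, it
    shows that the sphere is nonempty.\<close>
  moreover have "N ((1 / N 1) *\<^sub>R 1) = 1"
    by (rule is_norm_normalized[OF assms(2)]) (simp add: vec_eq_iff)
  moreover have "continuous_on {\<beta>. N \<beta> = 1} h"
    unfolding h_def neg_part_def by (intro continuous_intros)
  ultimately obtain m where "N m = 1" "(LEAST v. \<exists>\<beta>. N \<beta> = 1 \<and> v = h \<beta>) = h m"
      "\<And>\<gamma>. N \<gamma> = 1 \<Longrightarrow> h m \<le> h \<gamma>"
    by (rule Least_attained) blast
  then show thesis using that unfolding DegNSEP_def h_def by simp
qed

section \<open>The two inequalities\<close>

lemma matrix_vector_mult_nth_row:
  fixes A :: "real ^ 'p ^ 'n"
  shows "(A *v x) $ i = x \<bullet> row i A"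
  by (simp add: matrix_vector_mult_def inner_vec_def row_def mult.commute)

lemma row_add: "row i (A + B) = row i A + row i B"
  by (simp add: row_def vec_eq_iff)

lemma DegNSEP_le_op_norm1:
  fixes N :: "real ^ 'p \<Rightarrow> real" and X \<Delta> :: "real ^ 'p ^ 'n"
  assumes N: "is_norm N" and data: "is_dataset X y" and sep: "separable_data (X + \<Delta>) y"
  shows "DegNSEP N X y \<le> 1 / real CARD('n) * op_norm1 N \<Delta>"
proof -
  obtain \<beta> where \<beta>: "\<And>i. y $ i * (\<beta> \<bullet> row i (X + \<Delta>)) > 0"
    using sep by (auto simp: separable_data_def)
  \<comment> \<open>\<open>undefined\<close> serves as an arbitrary index; one strict inequality
    already excludes zero.\<close>
  have "\<beta> \<noteq> 0" using \<beta>[of undefined] by auto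
  \<comment> \<open>Positive scaling preserves separation and moves the separator onto the unit
    sphere.\<close>
  define \<gamma> where "\<gamma> = (1 / N \<beta>) *\<^sub>R \<beta>"
  have N\<gamma>: "N \<gamma> = 1"
    unfolding \<gamma>_def by (rule is_norm_normalized[OF N \<open>\<beta> \<noteq> 0\<close>])
  have "neg_part (y $ i * (\<gamma> \<bullet> row i X)) \<le> \<bar>(\<Delta> *v \<gamma>) $ i\<bar>" for i
  proof -
    have "y $ i * (\<gamma> \<bullet> row i (X + \<Delta>)) = 1 / N \<beta> * (y $ i * (\<beta> \<bullet> row i (X + \<Delta>)))"
      by (simp add: \<gamma>_def)
    also have "\<dots> > 0"
      using \<beta>[of i] is_norm_pos[OF N \<open>\<beta> \<noteq> 0\<close>] by simp
    finally have "y $ i * (\<gamma> \<bullet> row i X) + y $ i * (\<gamma> \<bullet> row i \<Delta>) > 0"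
      by (simp add: row_add inner_add_right distrib_left)
    moreover have "y $ i = 1 \<or> y $ i = -1"
      using data by (auto simp: is_dataset_def)
    ultimately show ?thesis
      by (auto simp: neg_part_def matrix_vector_mult_nth_row)
  qed
  then have "(\<Sum>i\<in>UNIV. neg_part (y $ i * (\<gamma> \<bullet> row i X))) \<le> l1_norm (\<Delta> *v \<gamma>)"
    unfolding l1_norm_def by (rule sum_mono)
  also have "\<dots> \<le> op_norm1 N \<Delta>"
    using op_norm1_attained[OF N, of \<Delta>] N\<gamma> by (metis order_refl)
  finally have "1 / real CARD('n) * (\<Sum>i\<in>UNIV. neg_part (y $ i * (\<gamma> \<bullet> row i X)))
      \<le> 1 / real CARD('n) * op_norm1 N \<Delta>"
    by (rule mult_left_mono) simp
  moreover have "DegNSEP N X y \<le> 1 / real CARD('n) * (\<Sum>i\<in>UNIV. neg_part (y $ i * (\<gamma> \<bullet> row i X)))"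
    using DegNSEP_attained[OF N, of X y] N\<gamma> by metis
  ultimately show ?thesis by linarith
qed

lemma separable_perturbation_near_DegNSEP:
  fixes N :: "real ^ 'p \<Rightarrow> real" and X :: "real ^ 'p ^ 'n"
  assumes N: "is_norm N" and data: "is_dataset X y" and \<epsilon>: "\<epsilon> > 0"
  obtains \<Delta> :: "real ^ 'p ^ 'n"
    where "separable_data (X + \<Delta>) y" "1 / real CARD('n) * op_norm1 N \<Delta> \<le> DegNSEP N X y + \<epsilon>"
proof -
  obtain \<beta> where \<beta>: "N \<beta> = 1"
    and Deg: "DegNSEP N X y = 1 / real CARD('n) * (\<Sum>i\<in>UNIV. neg_part (y $ i * (\<beta> \<bullet> row i X)))"
    by (rule DegNSEP_attained[OF N]) blast
  obtain u where u: "u \<bullet> \<beta> = 1" "\<And>x. \<bar>u \<bullet> x\<bar> \<le> N x"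
    by (rule is_norm_dual_vector[OF N \<beta>]) blast
  have y: "y $ i = 1 \<or> y $ i = -1" for i
    using data by (auto simp: is_dataset_def)
  \<comment> \<open>Adding the negative part lifts each margin only to at least 0;
    \<open>\<epsilon>\<close> makes it strictly positive.\<close>
  define c where "c i = neg_part (y $ i * (\<beta> \<bullet> row i X)) + \<epsilon>" for i
  have c: "c i \<ge> 0" for i
    using \<epsilon> by (auto simp: c_def neg_part_def)
  \<comment> \<open>The sign \<open>y $ i\<close> squares to 1 in the margin, which with
    \<open>u \<bullet> \<beta> = 1\<close> grows by exactly \<open>c i\<close>.\<close>
  define \<Delta> :: "real ^ 'p ^ 'n" where "\<Delta> = (\<chi> i. (y $ i * c i) *\<^sub>R u)"
  have row: "row i \<Delta> = (y $ i * c i) *\<^sub>R u" for i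
    by (simp add: \<Delta>_def row_def vec_eq_iff)
  have "y $ i * (\<beta> \<bullet> row i (X + \<Delta>)) > 0" for i
  proof -
    have "y $ i * (\<beta> \<bullet> row i (X + \<Delta>)) = y $ i * (\<beta> \<bullet> row i X) + c i"
      using y[of i] u(1) by (auto simp: row_add row inner_add_right inner_commute)
    then show ?thesis
      using \<epsilon> by (auto simp: c_def neg_part_def)
  qed
  then have sep: "separable_data (X + \<Delta>) y"
    by (auto simp: separable_data_def)
  obtain \<gamma> where \<gamma>: "N \<gamma> \<le> 1" "op_norm1 N \<Delta> = l1_norm (\<Delta> *v \<gamma>)"
    by (rule op_norm1_attained[OF N]) blast
  have "\<bar>(\<Delta> *v \<gamma>) $ i\<bar> \<le> c i" for i
  proof -
    have "\<bar>(\<Delta> *v \<gamma>) $ i\<bar> = c i * \<bar>u \<bullet> \<gamma>\<bar>"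
      using y[of i] c[of i]
      by (auto simp: matrix_vector_mult_nth_row row abs_mult inner_commute)
    also have "\<dots> \<le> c i * 1"
      using c[of i] u(2)[of \<gamma>] \<gamma>(1) by (intro mult_left_mono) auto
    finally show ?thesis by simp
  qed
  then have "op_norm1 N \<Delta> \<le> (\<Sum>i\<in>UNIV. c i)"
    unfolding \<gamma>(2) l1_norm_def by (rule sum_mono)
  then have "1 / real CARD('n) * op_norm1 N \<Delta> \<le> 1 / real CARD('n) * (\<Sum>i\<in>UNIV. c i)"
    by (rule mult_left_mono) simp
  also have "\<dots> = DegNSEP N X y + \<epsilon>"
    by (simp add: Deg c_def sum.distrib add_divide_distrib)
  finally show thesis
    using that sep by blast
qed

theorem proposition2p4:
  fixes N :: "real ^ 'p \<Rightarrow> real" and X :: "real ^ 'p ^ 'n" and y :: "real ^ 'n"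
  assumes "is_norm N" and "is_dataset X y"
  shows "DegNSEP N X y = PertSEP N X y"
proof -
  let ?S = "{1 / real CARD('n) * op_norm1 N \<Delta> | \<Delta>. separable_data (X + \<Delta>) y}"
  have lower: "DegNSEP N X y \<le> s" if "s \<in> ?S" for s
    using that DegNSEP_le_op_norm1[OF assms] by auto
  have near: "\<exists>s\<in>?S. s \<le> DegNSEP N X y + \<epsilon>" if "\<epsilon> > 0" for \<epsilon>
    using separable_perturbation_near_DegNSEP[OF assms that] by blast
  have "Inf ?S \<le> DegNSEP N X y + \<epsilon>" if "\<epsilon> > 0" for \<epsilon>
    using near[OF that] lower by (meson bdd_belowI cInf_lower2)
  then have "Inf ?S \<le> DegNSEP N X y"
    by (rule field_le_epsilon)
  \<comment> \<open>The choice of 1 is arbitrary: \<open>near\<close> is used here only to show that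
    \<open>?S\<close> is nonempty.\<close>
  moreover have "DegNSEP N X y \<le> Inf ?S"
    using near[OF zero_less_one] lower by (intro cInf_greatest) auto
  ultimately show ?thesis
    by (simp add: PertSEP_def)
qed

end
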